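(* Let $KB=\langle P,Ab,IC,K\rangle$ be a Horn knowledge base with $IC=\emptyset$, and let $*$ be a revision operator on $KB^{\bullet}$ satisfying all the AGM postulates $( *1)$ to $( *8)$. Define a revision function $\dotplus$ on $KB$ by: for every sentence $\alpha$, $KB\dotplus\alpha$ is a Horn knowledge base with $(KB\dotplus\alpha)^{\bullet}=KB^{\bullet}*\alpha$. Then $\dotplus$ satisfies all the rationality postulates $(\dotplus1)$ to $(\dotplus7)$.
   Context: Fix a first-order language $\mathcal{L}$; "sentence" means a sentence of $\mathcal{L}$. A Horn knowledge base is a tuple $KB=\langle P,Ab,IC,K\rangle$ where: $P$ is an acyclic normal logic program (there is a level mapping from ground atoms to $\mathbb{N}$ such that in every ground clause $H\leftarrow L_1,\dots,L_n$ of $P$ the level of $H$ exceeds that of each $L_i$, with $|\neg A|=|A|$), all abducibles at level $0$ and no non-abducible at level $0$; $Ab$ is a set of atoms (abducibles); $IC$ is a set of sentences (integrity constraints); $K$ is a set of sentences whose atoms are all in $Ab$. An abductive interpretation is a set $I\subseteq Ab$. A level-$0$ atom $A$ is true in $I$ iff $A\in I$; an atom $A$ of level $n>0$ is true in $I$ iff some clause $A\leftarrow L_1,\dots,L_k$ of the ground instantiation of $P$ has all positive $L_j$ true in $I$ and, for every negative $L_j=\neg B_j$, $B_j$ false in $I$. Truth extends to sentences classically ($\forall$/$\exists$ via ground instances). $Mod(X)$ is the set of abductive interpretations making the sentence (or all sentences of the set) $X$ true; $Cn_P(X)=\{\alpha: Mod(X)\subseteq Mod(\alpha)\}$; $Mod(KB)=Mod(K\cup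 IC)$; $KB^\bullet=Cn_P(K\cup IC)$; $\alpha$ is accepted in $KB$ iff $\alpha\in KB^\bullet$. $KB_1\equiv KB_2$ iff $P_1=P_2,Ab_1=Ab_2,IC_1=IC_2$ and $Mod(K_1)=Mod(K_2)$. $Mod(KB+\alpha)=Mod(KB)\cap Mod(\alpha)$. Revision postulates for $KB\dotplus\alpha=\langle P',Ab',IC',K'\rangle$: $(\dotplus1)$ $P'=P,Ab'=Ab,IC'=IC$; $(\dotplus2)$ $\alpha$ accepted in $KB\dotplus\alpha$; $(\dotplus3)$ $Mod(\{\alpha\}\cup IC)\neq\emptyset$ iff $Mod(KB\dotplus\alpha)\neq\emptyset$; $(\dotplus4)$ if $\neg\alpha$ is not accepted in $KB$ then $Mod(KB\dotplus\alpha)=Mod(KB)\cap Mod(\alpha)$; $(\dotplus5)$ if $KB\equiv KB'$ and $Mod(\alpha)=Mod(\beta)$ then $Mod(KB\dotplus\alpha)=Mod(KB'\dotplus\beta)$; $(\dotplus6)$ $Mod(KB\dotplus\alpha)\cap Mod(\beta)\subseteq Mod(KB\dotplus(\alpha\land\beta))$; $(\dotplus7)$ if $\neg\beta$ is not accepted in $KB\dotplus\alpha$ then $Mod(KB\dotplus(\alpha\land\beta))\subseteq Mod(KB\dotplus\alpha)\cap Mod(\beta)$. AGM setting (with respect to $Cn_P$): a belief set is a set $T$ of sentences with $T=Cn_P(T)$; $T\#\alpha=Cn_P(T\cup\{\alpha\})$; $T$ is inconsistent iff some $\varphi$ and $\neg\varphi$ both lie in $T$; $\vdash\varphi$ means $\varphi\in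 Cn_P(\emptyset)$. AGM revision postulates for $T=KB^\bullet$: $( *1)$ $T*\alpha$ is a belief set; $( *2)$ $\alpha\in T*\alpha$; $( *3)$ $T*\alpha\subseteq T\#\alpha$; $( *4)$ if $\neg\alpha\notin T$ then $T\#\alpha\subseteq T*\alpha$; $( *5)$ $T*\alpha$ is inconsistent iff $\vdash\neg\alpha$; $( *6)$ if $\vdash\alpha\leftrightarrow\beta$ then $T*\alpha=T*\beta$; $( *7)$ $T*(\alpha\land\beta)\subseteq(T*\alpha)\#\beta$; $( *8)$ if $\neg\beta\notin T*\alpha$ then $(T*\alpha)\#\beta\subseteq T*(\alpha\land\beta)$.
   Formalization: The revision function is additionally required to keep P, Ab and IC unchanged (otherwise the first postulate can fail, e.g. by adding a subsumed clause to P), and to be defined by the same equation on every Horn knowledge base equivalent to KB, as the fifth postulate needs. *)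

theory Defs
  imports Main
begin

section \<open>First-order syntax\<close>

text \<open>Symbols are name/arity pairs. No constant symbol is required to exist, and
  equality is not a logical symbol.\<close>

record ('f, 'p) language =
  funs :: "('f \<times> nat) set"
  preds :: "('p \<times> nat) set"

datatype 'f tm = Var nat | Fun 'f "'f tm list"

datatype ('f, 'p) atm = Atm 'p "'f tm list"

datatype ('f, 'p) fm =
    FAtom "('f, 'p) atm"
  | FNot "('f, 'p) fm"
  | FAnd "('f, 'p) fm" "('f, 'p) fm"
  | FOr "('f, 'p) fm" "('f, 'p) fm"
  | FImp "('f, 'p) fm" "('f, 'p) fm"
  | FIff "('f, 'p) fm" "('f, 'p) fm"
  | FAll nat "('f, 'p) fm"
  | FEx nat "('f, 'p) fm"

fun wf_tm :: "('f, 'p) language \<Rightarrow> 'f tm \<Rightarrow> bool" where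
  "wf_tm L (Var x) \<longleftrightarrow> True"
| "wf_tm L (Fun f ts) \<longleftrightarrow> (f, length ts) \<in> funs L \<and> (\<forall>t\<in>set ts. wf_tm L t)"

fun wf_atm :: "('f, 'p) language \<Rightarrow> ('f, 'p) atm \<Rightarrow> bool" where
  "wf_atm L (Atm p ts) \<longleftrightarrow> (p, length ts) \<in> preds L \<and> (\<forall>t\<in>set ts. wf_tm L t)"

fun vars_tm :: "'f tm \<Rightarrow> nat set" where
  "vars_tm (Var x) = {x}"
| "vars_tm (Fun f ts) = (\<Union>t\<in>set ts. vars_tm t)"

fun vars_atm :: "('f, 'p) atm \<Rightarrow> nat set" where
  "vars_atm (Atm p ts) = (\<Union>t\<in>set ts. vars_tm t)"

fun subst_tm :: "(nat \<Rightarrow> 'f tm) \<Rightarrow> 'f tm \<Rightarrow> 'f tm" where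
  "subst_tm \<sigma> (Var x) = \<sigma> x"
| "subst_tm \<sigma> (Fun f ts) = Fun f (map (subst_tm \<sigma>) ts)"

fun subst_atm :: "(nat \<Rightarrow> 'f tm) \<Rightarrow> ('f, 'p) atm \<Rightarrow> ('f, 'p) atm" where
  "subst_atm \<sigma> (Atm p ts) = Atm p (map (subst_tm \<sigma>) ts)"

definition ground_terms :: "('f, 'p) language \<Rightarrow> 'f tm set" where
  "ground_terms L = {t. wf_tm L t \<and> vars_tm t = {}}"

definition ground_atoms :: "('f, 'p) language \<Rightarrow> ('f, 'p) atm set" where
  "ground_atoms L = {A. wf_atm L A \<and> vars_atm A = {}}"

fun free_vars :: "('f, 'p) fm \<Rightarrow> nat set" where
  "free_vars (FAtom A) = vars_atm A"
| "free_vars (FNot \<phi>) = free_vars \<phi>"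
| "free_vars (FAnd \<phi> \<psi>) = free_vars \<phi> \<union> free_vars \<psi>"
| "free_vars (FOr \<phi> \<psi>) = free_vars \<phi> \<union> free_vars \<psi>"
| "free_vars (FImp \<phi> \<psi>) = free_vars \<phi> \<union> free_vars \<psi>"
| "free_vars (FIff \<phi> \<psi>) = free_vars \<phi> \<union> free_vars \<psi>"
| "free_vars (FAll x \<phi>) = free_vars \<phi> - {x}"
| "free_vars (FEx x \<phi>) = free_vars \<phi> - {x}"

fun atoms_fm :: "('f, 'p) fm \<Rightarrow> ('f, 'p) atm set" where
  "atoms_fm (FAtom A) = {A}"
| "atoms_fm (FNot \<phi>) = atoms_fm \<phi>"
| "atoms_fm (FAnd \<phi> \<psi>) = atoms_fm \<phi> \<union> atoms_fm \<psi>"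
| "atoms_fm (FOr \<phi> \<psi>) = atoms_fm \<phi> \<union> atoms_fm \<psi>"
| "atoms_fm (FImp \<phi> \<psi>) = atoms_fm \<phi> \<union> atoms_fm \<psi>"
| "atoms_fm (FIff \<phi> \<psi>) = atoms_fm \<phi> \<union> atoms_fm \<psi>"
| "atoms_fm (FAll x \<phi>) = atoms_fm \<phi>"
| "atoms_fm (FEx x \<phi>) = atoms_fm \<phi>"

definition sentences :: "('f, 'p) language \<Rightarrow> ('f, 'p) fm set" where
  "sentences L = {\<phi>. (\<forall>A\<in>atoms_fm \<phi>. wf_atm L A) \<and> free_vars \<phi> = {}}"

text \<open>The ground atoms a sentence speaks about: under a quantifier these are all the
  ground instances of the atoms that occur.\<close>

definition ground_atoms_of :: "('f, 'p) language \<Rightarrow> ('f, 'p) fm \<Rightarrow> ('f, 'p) atm set" where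
  "ground_atoms_of L \<phi> = {subst_atm \<sigma> A | \<sigma> A. A \<in> atoms_fm \<phi>} \<inter> ground_atoms L"

text \<open>Replaces the free occurrences of a variable; only used with a ground term,
  so that no capture can occur.\<close>

fun inst :: "nat \<Rightarrow> 'f tm \<Rightarrow> ('f, 'p) fm \<Rightarrow> ('f, 'p) fm" where
  "inst x t (FAtom A) = FAtom (subst_atm (Var(x := t)) A)"
| "inst x t (FNot \<phi>) = FNot (inst x t \<phi>)"
| "inst x t (FAnd \<phi> \<psi>) = FAnd (inst x t \<phi>) (inst x t \<psi>)"
| "inst x t (FOr \<phi> \<psi>) = FOr (inst x t \<phi>) (inst x t \<psi>)"
| "inst x t (FImp \<phi> \<psi>) = FImp (inst x t \<phi>) (inst x t \<psi>)"
| "inst x t (FIff \<phi> \<psi>) = FIff (inst x t \<phi>) (inst x t \<psi>)"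
| "inst x t (FAll y \<phi>) = FAll y (if x = y then \<phi> else inst x t \<phi>)"
| "inst x t (FEx y \<phi>) = FEx y (if x = y then \<phi> else inst x t \<phi>)"

fun fm_rank :: "('f, 'p) fm \<Rightarrow> nat" where
  "fm_rank (FAtom A) = 0"
| "fm_rank (FNot \<phi>) = Suc (fm_rank \<phi>)"
| "fm_rank (FAnd \<phi> \<psi>) = Suc (fm_rank \<phi> + fm_rank \<psi>)"
| "fm_rank (FOr \<phi> \<psi>) = Suc (fm_rank \<phi> + fm_rank \<psi>)"
| "fm_rank (FImp \<phi> \<psi>) = Suc (fm_rank \<phi> + fm_rank \<psi>)"
| "fm_rank (FIff \<phi> \<psi>) = Suc (fm_rank \<phi> + fm_rank \<psi>)"
| "fm_rank (FAll x \<phi>) = Suc (fm_rank \<phi>)"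
| "fm_rank (FEx x \<phi>) = Suc (fm_rank \<phi>)"

lemma fm_rank_inst [simp]: "fm_rank (inst x t \<phi>) = fm_rank \<phi>"
  by (induction \<phi>) auto


section \<open>Acyclic normal logic programs\<close>

datatype ('f, 'p) literal =
    Pos (lit_atm: "('f, 'p) atm")
  | Neg (lit_atm: "('f, 'p) atm")

datatype ('f, 'p) clause =
  Clause (head: "('f, 'p) atm") (body: "('f, 'p) literal list")

definition wf_clause :: "('f, 'p) language \<Rightarrow> ('f, 'p) clause \<Rightarrow> bool" where
  "wf_clause L C \<longleftrightarrow> wf_atm L (head C) \<and> (\<forall>l\<in>set (body C). wf_atm L (lit_atm l))"

definition ground_clause :: "('f, 'p) language \<Rightarrow> ('f, 'p) clause \<Rightarrow> bool" where
  "ground_clause L C \<longleftrightarrow>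
     head C \<in> ground_atoms L \<and> (\<forall>l\<in>set (body C). lit_atm l \<in> ground_atoms L)"

fun subst_literal :: "(nat \<Rightarrow> 'f tm) \<Rightarrow> ('f, 'p) literal \<Rightarrow> ('f, 'p) literal" where
  "subst_literal \<sigma> (Pos A) = Pos (subst_atm \<sigma> A)"
| "subst_literal \<sigma> (Neg A) = Neg (subst_atm \<sigma> A)"

fun subst_clause :: "(nat \<Rightarrow> 'f tm) \<Rightarrow> ('f, 'p) clause \<Rightarrow> ('f, 'p) clause" where
  "subst_clause \<sigma> (Clause A ls) = Clause (subst_atm \<sigma> A) (map (subst_literal \<sigma>) ls)"

definition ground_inst ::
  "('f, 'p) language \<Rightarrow> ('f, 'p) clause set \<Rightarrow> ('f, 'p) clause set" where
  "ground_inst L P = {C'. ground_clause L C' \<and> (\<exists>\<sigma>. \<exists>C\<in>P. C' = subst_clause \<sigma> C)}"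

text \<open>Only the values on \<^term>\<open>ground_atoms L\<close> are meaningful.\<close>

definition level_mapping ::
  "('f, 'p) language \<Rightarrow> ('f, 'p) clause set \<Rightarrow> ('f, 'p) atm set \<Rightarrow>
   (('f, 'p) atm \<Rightarrow> nat) \<Rightarrow> bool" where
  "level_mapping L P Ab lev \<longleftrightarrow>
     (\<forall>C\<in>ground_inst L P. \<forall>l\<in>set (body C). lev (lit_atm l) < lev (head C)) \<and>
     (\<forall>A\<in>ground_atoms L. lev A = 0 \<longleftrightarrow> A \<in> Ab)"


section \<open>Truth in an abductive interpretation\<close>

text \<open>The conjunct comparing levels makes the recursion terminate for an arbitrary
  \<^term>\<open>lev\<close>; for a level mapping it holds in every ground clause, see
  \<open>atom_true_level_mapping\<close> below.\<close>

context
  notes conj_cong [fundef_cong]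
begin

function atom_true ::
  "(('f, 'p) atm \<Rightarrow> nat) \<Rightarrow> ('f, 'p) clause set \<Rightarrow> ('f, 'p) atm set \<Rightarrow> ('f, 'p) atm \<Rightarrow> bool"
where
  "atom_true lev G I A \<longleftrightarrow>
     (if lev A = 0 then A \<in> I
      else \<exists>C\<in>G. head C = A \<and>
             (\<forall>l\<in>set (body C). lev (lit_atm l) < lev A \<and>
                (case l of Pos B \<Rightarrow> atom_true lev G I B
                         | Neg B \<Rightarrow> \<not> atom_true lev G I B)))"
  by pat_completeness auto
termination
  by (relation "measure (\<lambda>(lev, G, I, A). lev A)") auto

end

declare atom_true.simps [simp del]

lemma atom_true_level_mapping:
  assumes lev: "level_mapping L P Ab lev" and A: "A \<in> ground_atoms L"
  shows "atom_true lev (ground_inst L P) I A \<longleftrightarrow>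
     (if A \<in> Ab then A \<in> I
      else \<exists>C\<in>ground_inst L P. head C = A \<and>
             (\<forall>l\<in>set (body C).
                case l of Pos B \<Rightarrow> atom_true lev (ground_inst L P) I B
                        | Neg B \<Rightarrow> \<not> atom_true lev (ground_inst L P) I B))"
proof -
  have "lev A = 0 \<longleftrightarrow> A \<in> Ab"
    and "\<And>C l. C \<in> ground_inst L P \<Longrightarrow> l \<in> set (body C) \<Longrightarrow> lev (lit_atm l) < lev (head C)"
    using lev A by (auto simp: level_mapping_def)
  then show ?thesis
    by (subst atom_true.simps) (auto split: if_splits)
qed

text \<open>Truth of ground atoms does not depend on the choice of the level mapping.\<close>

lemma atom_true_level_mapping_unique:
  assumes lev: "level_mapping L P Ab lev" and lev': "level_mapping L P Ab lev'"
    and A: "A \<in> ground_atoms L"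
  shows "atom_true lev (ground_inst L P) I A \<longleftrightarrow> atom_true lev' (ground_inst L P) I A"
  using A
proof (induction "lev A" arbitrary: A rule: less_induct)
  case less
  have IH: "atom_true lev (ground_inst L P) I (lit_atm l) \<longleftrightarrow>
            atom_true lev' (ground_inst L P) I (lit_atm l)"
    if "C \<in> ground_inst L P" "head C = A" "l \<in> set (body C)" for C l
  proof (rule less.hyps)
    show "lev (lit_atm l) < lev A"
      using that lev by (auto simp: level_mapping_def)
    show "lit_atm l \<in> ground_atoms L"
      using that by (auto simp: ground_inst_def ground_clause_def)
  qed
  have "(\<forall>l\<in>set (body C). case l of Pos B \<Rightarrow> atom_true lev (ground_inst L P) I B
                                  | Neg B \<Rightarrow> \<not> atom_true lev (ground_inst L P) I B) \<longleftrightarrow>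
        (\<forall>l\<in>set (body C). case l of Pos B \<Rightarrow> atom_true lev' (ground_inst L P) I B
                                  | Neg B \<Rightarrow> \<not> atom_true lev' (ground_inst L P) I B)"
    if "C \<in> ground_inst L P" "head C = A" for C
    using IH[OF that] by (intro ball_cong refl) (force split: literal.split)
  then show ?case
    unfolding atom_true_level_mapping[OF lev less.prems] atom_true_level_mapping[OF lev' less.prems]
    by auto
qed

function fm_true :: "'f tm set \<Rightarrow> (('f, 'p) atm \<Rightarrow> bool) \<Rightarrow> ('f, 'p) fm \<Rightarrow> bool" where
  "fm_true U v (FAtom A) \<longleftrightarrow> v A"
| "fm_true U v (FNot \<phi>) \<longleftrightarrow> \<not> fm_true U v \<phi>"
| "fm_true U v (FAnd \<phi> \<psi>) \<longleftrightarrow> fm_true U v \<phi> \<and> fm_true U v \<psi>"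
| "fm_true U v (FOr \<phi> \<psi>) \<longleftrightarrow> fm_true U v \<phi> \<or> fm_true U v \<psi>"
| "fm_true U v (FImp \<phi> \<psi>) \<longleftrightarrow> (fm_true U v \<phi> \<longrightarrow> fm_true U v \<psi>)"
| "fm_true U v (FIff \<phi> \<psi>) \<longleftrightarrow> (fm_true U v \<phi> \<longleftrightarrow> fm_true U v \<psi>)"
| "fm_true U v (FAll x \<phi>) \<longleftrightarrow> (\<forall>t\<in>U. fm_true U v (inst x t \<phi>))"
| "fm_true U v (FEx x \<phi>) \<longleftrightarrow> (\<exists>t\<in>U. fm_true U v (inst x t \<phi>))"
  by pat_completeness auto
termination
  by (relation "measure (\<lambda>(U, v, \<phi>). fm_rank \<phi>)") auto

definition holds ::
  "('f, 'p) language \<Rightarrow> ('f, 'p) clause set \<Rightarrow> ('f, 'p) atm set \<Rightarrow>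
   ('f, 'p) atm set \<Rightarrow> ('f, 'p) fm \<Rightarrow> bool" where
  "holds L P Ab I \<phi> \<longleftrightarrow>
     fm_true (ground_terms L)
       (atom_true (SOME lev. level_mapping L P Ab lev) (ground_inst L P) I) \<phi>"

definition Mod ::
  "('f, 'p) language \<Rightarrow> ('f, 'p) clause set \<Rightarrow> ('f, 'p) atm set \<Rightarrow>
   ('f, 'p) fm set \<Rightarrow> ('f, 'p) atm set set" where
  "Mod L P Ab X = {I. I \<subseteq> Ab \<and> (\<forall>\<phi>\<in>X. holds L P Ab I \<phi>)}"

definition Cn ::
  "('f, 'p) language \<Rightarrow> ('f, 'p) clause set \<Rightarrow> ('f, 'p) atm set \<Rightarrow>
   ('f, 'p) fm set \<Rightarrow> ('f, 'p) fm set" where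
  "Cn L P Ab X = {\<alpha> \<in> sentences L. Mod L P Ab X \<subseteq> Mod L P Ab {\<alpha>}}"


section \<open>Horn knowledge bases and their revision\<close>

record ('f, 'p) kb =
  program :: "('f, 'p) clause set"
  abducibles :: "('f, 'p) atm set"
  constraints :: "('f, 'p) fm set"
  knowledge :: "('f, 'p) fm set"

definition horn_kb :: "('f, 'p) language \<Rightarrow> ('f, 'p) kb \<Rightarrow> bool" where
  "horn_kb L KB \<longleftrightarrow>
     (\<forall>C\<in>program KB. wf_clause L C) \<and>
     abducibles KB \<subseteq> ground_atoms L \<and>
     (\<exists>lev. level_mapping L (program KB) (abducibles KB) lev) \<and>
     constraints KB \<subseteq> sentences L \<and>
     knowledge KB \<subseteq> sentences L \<and>
     (\<forall>\<phi>\<in>knowledge KB. ground_atoms_of L \<phi> \<subseteq> abducibles KB)"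

definition Mod_kb :: "('f, 'p) language \<Rightarrow> ('f, 'p) kb \<Rightarrow> ('f, 'p) atm set set" where
  "Mod_kb L KB = Mod L (program KB) (abducibles KB) (knowledge KB \<union> constraints KB)"

definition kb_closure :: "('f, 'p) language \<Rightarrow> ('f, 'p) kb \<Rightarrow> ('f, 'p) fm set" where
  "kb_closure L KB = Cn L (program KB) (abducibles KB) (knowledge KB \<union> constraints KB)"

definition accepted :: "('f, 'p) language \<Rightarrow> ('f, 'p) kb \<Rightarrow> ('f, 'p) fm \<Rightarrow> bool" where
  "accepted L KB \<alpha> \<longleftrightarrow> \<alpha> \<in> kb_closure L KB"

definition kb_equiv :: "('f, 'p) language \<Rightarrow> ('f, 'p) kb \<Rightarrow> ('f, 'p) kb \<Rightarrow> bool" where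
  "kb_equiv L KB KB' \<longleftrightarrow>
     program KB = program KB' \<and>
     abducibles KB = abducibles KB' \<and>
     constraints KB = constraints KB' \<and>
     Mod L (program KB) (abducibles KB) (knowledge KB) =
       Mod L (program KB') (abducibles KB') (knowledge KB')"

text \<open>The seven postulates for a revision function on knowledge bases, at the
  knowledge base \<^term>\<open>KB\<close>.\<close>

definition kb_revision_postulates ::
  "('f, 'p) language \<Rightarrow> ('f, 'p) kb \<Rightarrow> (('f, 'p) kb \<Rightarrow> ('f, 'p) fm \<Rightarrow> ('f, 'p) kb) \<Rightarrow> bool" where
  "kb_revision_postulates L KB revise \<longleftrightarrow>
     (let S = sentences L; M = (\<lambda>X. Mod L (program KB) (abducibles KB) X) in
       (\<forall>\<alpha>\<in>S. program (revise KB \<alpha>) = program KB \<and>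
               abducibles (revise KB \<alpha>) = abducibles KB \<and>
               constraints (revise KB \<alpha>) = constraints KB) \<and>
       (\<forall>\<alpha>\<in>S. accepted L (revise KB \<alpha>) \<alpha>) \<and>
       (\<forall>\<alpha>\<in>S. M ({\<alpha>} \<union> constraints KB) \<noteq> {} \<longleftrightarrow> Mod_kb L (revise KB \<alpha>) \<noteq> {}) \<and>
       (\<forall>\<alpha>\<in>S. \<not> accepted L KB (FNot \<alpha>) \<longrightarrow>
               Mod_kb L (revise KB \<alpha>) = Mod_kb L KB \<inter> M {\<alpha>}) \<and>
       (\<forall>KB'. \<forall>\<alpha>\<in>S. \<forall>\<beta>\<in>S. horn_kb L KB' \<and> kb_equiv L KB KB' \<and> M {\<alpha>} = M {\<beta>} \<longrightarrow>
               Mod_kb L (revise KB \<alpha>) = Mod_kb L (revise KB' \<beta>)) \<and>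
       (\<forall>\<alpha>\<in>S. \<forall>\<beta>\<in>S. Mod_kb L (revise KB \<alpha>) \<inter> M {\<beta>} \<subseteq> Mod_kb L (revise KB (FAnd \<alpha> \<beta>))) \<and>
       (\<forall>\<alpha>\<in>S. \<forall>\<beta>\<in>S. \<not> accepted L (revise KB \<alpha>) (FNot \<beta>) \<longrightarrow>
               Mod_kb L (revise KB (FAnd \<alpha> \<beta>)) \<subseteq> Mod_kb L (revise KB \<alpha>) \<inter> M {\<beta>}))"


section \<open>AGM revision\<close>

definition belief_set ::
  "('f, 'p) language \<Rightarrow> ('f, 'p) clause set \<Rightarrow> ('f, 'p) atm set \<Rightarrow> ('f, 'p) fm set \<Rightarrow> bool" where
  "belief_set L P Ab T \<longleftrightarrow> T \<subseteq> sentences L \<and> T = Cn L P Ab T"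

definition expansion ::
  "('f, 'p) language \<Rightarrow> ('f, 'p) clause set \<Rightarrow> ('f, 'p) atm set \<Rightarrow>
   ('f, 'p) fm set \<Rightarrow> ('f, 'p) fm \<Rightarrow> ('f, 'p) fm set" where
  "expansion L P Ab T \<alpha> = Cn L P Ab (T \<union> {\<alpha>})"

definition inconsistent :: "('f, 'p) fm set \<Rightarrow> bool" where
  "inconsistent T \<longleftrightarrow> (\<exists>\<phi>. \<phi> \<in> T \<and> FNot \<phi> \<in> T)"

text \<open>The eight AGM postulates for a revision operator, at the belief set \<^term>\<open>T\<close>.\<close>

definition agm_revision_postulates ::
  "('f, 'p) language \<Rightarrow> ('f, 'p) clause set \<Rightarrow> ('f, 'p) atm set \<Rightarrow> ('f, 'p) fm set \<Rightarrow>
   (('f, 'p) fm set \<Rightarrow> ('f, 'p) fm \<Rightarrow> ('f, 'p) fm set) \<Rightarrow> bool" where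
  "agm_revision_postulates L P Ab T star \<longleftrightarrow>
     (let S = sentences L; E = expansion L P Ab; valid = (\<lambda>\<phi>. \<phi> \<in> Cn L P Ab {}) in
       (\<forall>\<alpha>\<in>S. belief_set L P Ab (star T \<alpha>)) \<and>
       (\<forall>\<alpha>\<in>S. \<alpha> \<in> star T \<alpha>) \<and>
       (\<forall>\<alpha>\<in>S. star T \<alpha> \<subseteq> E T \<alpha>) \<and>
       (\<forall>\<alpha>\<in>S. FNot \<alpha> \<notin> T \<longrightarrow> E T \<alpha> \<subseteq> star T \<alpha>) \<and>
       (\<forall>\<alpha>\<in>S. inconsistent (star T \<alpha>) \<longleftrightarrow> valid (FNot \<alpha>)) \<and>
       (\<forall>\<alpha>\<in>S. \<forall>\<beta>\<in>S. valid (FIff \<alpha> \<beta>) \<longrightarrow> star T \<alpha> = star T \<beta>) \<and>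
       (\<forall>\<alpha>\<in>S. \<forall>\<beta>\<in>S. star T (FAnd \<alpha> \<beta>) \<subseteq> E (star T \<alpha>) \<beta>) \<and>
       (\<forall>\<alpha>\<in>S. \<forall>\<beta>\<in>S. FNot \<beta> \<notin> star T \<alpha> \<longrightarrow> E (star T \<alpha>) \<beta> \<subseteq> star T (FAnd \<alpha> \<beta>)))"

end

theory Submission
  imports Defs
begin

text \<open>A set of sentences and its closure under \<^const>\<open>Cn\<close> have the same models, so the
  models of the revised knowledge base are those of the AGM revision of \<open>T = KB\<^sup>\<bullet>\<close>, and each AGM
  postulate, read on the side of models, becomes a postulate for knowledge bases. Postulate
  \<open>5\<close> speaks of other knowledge bases, but equivalent ones have the same closure. With \<open>IC = {}\<close>
  the satisfiability condition of postulate \<open>3\<close> is precisely that \<open>\<not>\<alpha>\<close> is not valid.\<close>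

lemma FNot_in_sentences_iff [simp]: "FNot \<phi> \<in> sentences L \<longleftrightarrow> \<phi> \<in> sentences L"
  by (simp add: sentences_def)

lemma FAnd_in_sentences_iff [simp]:
  "FAnd \<phi> \<psi> \<in> sentences L \<longleftrightarrow> \<phi> \<in> sentences L \<and> \<psi> \<in> sentences L"
  by (auto simp: sentences_def)

lemma FIff_in_sentences_iff [simp]:
  "FIff \<phi> \<psi> \<in> sentences L \<longleftrightarrow> \<phi> \<in> sentences L \<and> \<psi> \<in> sentences L"
  by (auto simp: sentences_def)

lemma Mod_empty [simp]: "Mod L P Ab {} = Pow Ab"
  by (auto simp: Mod_def)

lemma Mod_subset_Pow: "Mod L P Ab X \<subseteq> Pow Ab"
  by (auto simp: Mod_def)

lemma Mod_Un: "Mod L P Ab (X \<union> Y) = Mod L P Ab X \<inter> Mod L P Ab Y"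
  by (auto simp: Mod_def)

lemma Mod_antimono: "X \<subseteq> Y \<Longrightarrow> Mod L P Ab Y \<subseteq> Mod L P Ab X"
  by (auto simp: Mod_def)

lemma Mod_FNot: "Mod L P Ab {FNot \<phi>} = Pow Ab - Mod L P Ab {\<phi>}"
  by (auto simp: Mod_def holds_def)

lemma Mod_FIff:
  "Mod L P Ab {FIff \<phi> \<psi>} = {I \<in> Pow Ab. I \<in> Mod L P Ab {\<phi>} \<longleftrightarrow> I \<in> Mod L P Ab {\<psi>}}"
  by (auto simp: Mod_def holds_def)

lemma Cn_subset_sentences: "Cn L P Ab X \<subseteq> sentences L"
  by (auto simp: Cn_def)

lemma subset_Cn: "X \<subseteq> sentences L \<Longrightarrow> X \<subseteq> Cn L P Ab X"
  by (auto simp: Cn_def Mod_def)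

lemma Mod_Cn:
  assumes "X \<subseteq> sentences L"
  shows "Mod L P Ab (Cn L P Ab X) = Mod L P Ab X"
proof
  show "Mod L P Ab (Cn L P Ab X) \<subseteq> Mod L P Ab X"
    by (intro Mod_antimono subset_Cn assms)
  show "Mod L P Ab X \<subseteq> Mod L P Ab (Cn L P Ab X)"
    by (auto simp: Cn_def Mod_def)
qed

lemma Mod_expansion:
  assumes "T \<subseteq> sentences L" "\<alpha> \<in> sentences L"
  shows "Mod L P Ab (expansion L P Ab T \<alpha>) = Mod L P Ab T \<inter> Mod L P Ab {\<alpha>}"
  using assms by (simp only: expansion_def Mod_Cn Mod_Un Un_subset_iff empty_subsetI insert_subset)

lemma FNot_in_Cn_iff:
  assumes "\<alpha> \<in> sentences L"
  shows "FNot \<alpha> \<in> Cn L P Ab X \<longleftrightarrow> Mod L P Ab X \<inter> Mod L P Ab {\<alpha>} = {}"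
  using assms Mod_subset_Pow[of L P Ab X] by (auto simp: Cn_def Mod_FNot)

lemma FIff_in_Cn_iff:
  assumes "\<alpha> \<in> sentences L" "\<beta> \<in> sentences L"
  shows "FIff \<alpha> \<beta> \<in> Cn L P Ab X \<longleftrightarrow>
    Mod L P Ab X \<inter> Mod L P Ab {\<alpha>} = Mod L P Ab X \<inter> Mod L P Ab {\<beta>}"
  using assms Mod_subset_Pow[of L P Ab X] by (auto simp: Cn_def Mod_FIff)

lemma inconsistent_iff_Mod_eq_empty:
  assumes "belief_set L P Ab T" "T \<noteq> {}"
  shows "inconsistent T \<longleftrightarrow> Mod L P Ab T = {}"
proof
  assume "inconsistent T"
  then obtain \<phi> where "\<phi> \<in> T" "FNot \<phi> \<in> T"
    by (auto simp: inconsistent_def)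
  then have "Mod L P Ab T \<subseteq> Mod L P Ab {\<phi>} \<inter> Mod L P Ab {FNot \<phi>}"
    by (simp add: Mod_antimono)
  then show "Mod L P Ab T = {}"
    unfolding Mod_FNot by blast
next
  assume "Mod L P Ab T = {}"
  then have "T = sentences L"
    using assms(1) by (auto simp: belief_set_def Cn_def)
  then show "inconsistent T"
    using assms(2) by (auto simp: inconsistent_def)
qed

locale agm_revision =
  fixes L :: "('f, 'p) language"
    and P :: "('f, 'p) clause set"
    and Ab :: "('f, 'p) atm set"
    and T :: "('f, 'p) fm set"
    and star :: "('f, 'p) fm set \<Rightarrow> ('f, 'p) fm \<Rightarrow> ('f, 'p) fm set"
  assumes subset_sentences: "T \<subseteq> sentences L"
    and postulates: "agm_revision_postulates L P Ab T star"
begin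

lemma
  assumes "\<alpha> \<in> sentences L"
  shows belief_set_star: "belief_set L P Ab (star T \<alpha>)"
    and success: "\<alpha> \<in> star T \<alpha>"
    and inclusion: "star T \<alpha> \<subseteq> expansion L P Ab T \<alpha>"
    and vacuity: "FNot \<alpha> \<notin> T \<Longrightarrow> expansion L P Ab T \<alpha> \<subseteq> star T \<alpha>"
    and consistency: "inconsistent (star T \<alpha>) \<longleftrightarrow> FNot \<alpha> \<in> Cn L P Ab {}"
  using postulates assms unfolding agm_revision_postulates_def Let_def by meson+

lemma
  assumes "\<alpha> \<in> sentences L" "\<beta> \<in> sentences L"
  shows extensionality: "FIff \<alpha> \<beta> \<in> Cn L P Ab {} \<Longrightarrow> star T \<alpha> = star T \<beta>"
    and superexpansion: "star T (FAnd \<alpha> \<beta>) \<subseteq> expansion L P Ab (star T \<alpha>) \<beta>"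
    and subexpansion:
      "FNot \<beta> \<notin> star T \<alpha> \<Longrightarrow> expansion L P Ab (star T \<alpha>) \<beta> \<subseteq> star T (FAnd \<alpha> \<beta>)"
  using postulates assms unfolding agm_revision_postulates_def Let_def by meson+

lemma star_subset_sentences: "\<alpha> \<in> sentences L \<Longrightarrow> star T \<alpha> \<subseteq> sentences L"
  using belief_set_star by (simp add: belief_set_def)

lemma Mod_star_eq_empty_iff:
  assumes "\<alpha> \<in> sentences L"
  shows "Mod L P Ab (star T \<alpha>) = {} \<longleftrightarrow> Mod L P Ab {\<alpha>} = {}"
proof -
  have "star T \<alpha> \<noteq> {}"
    using success[OF assms] by auto
  then have "Mod L P Ab (star T \<alpha>) = {} \<longleftrightarrow> inconsistent (star T \<alpha>)"
    by (simp add: inconsistent_iff_Mod_eq_empty[OF belief_set_star[OF assms]])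
  also have "\<dots> \<longleftrightarrow> FNot \<alpha> \<in> Cn L P Ab {}"
    by (rule consistency[OF assms])
  also have "\<dots> \<longleftrightarrow> Mod L P Ab {\<alpha>} = {}"
    by (simp add: FNot_in_Cn_iff[OF assms] Int_absorb1 Mod_subset_Pow)
  finally show ?thesis .
qed

lemma Mod_star_eq_Int:
  assumes "\<alpha> \<in> sentences L" "FNot \<alpha> \<notin> T"
  shows "Mod L P Ab (star T \<alpha>) = Mod L P Ab T \<inter> Mod L P Ab {\<alpha>}"
proof -
  have "star T \<alpha> = expansion L P Ab T \<alpha>"
    using assms by (intro equalityI inclusion vacuity)
  then show ?thesis
    using assms(1) by (simp add: Mod_expansion subset_sentences)
qed

lemma star_cong_Mod:
  assumes "\<alpha> \<in> sentences L" "\<beta> \<in> sentences L" "Mod L P Ab {\<alpha>} = Mod L P Ab {\<beta>}"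
  shows "star T \<alpha> = star T \<beta>"
  using assms by (intro extensionality) (simp_all add: FIff_in_Cn_iff)

lemma Mod_star_Int_subset_FAnd:
  assumes "\<alpha> \<in> sentences L" "\<beta> \<in> sentences L"
  shows "Mod L P Ab (star T \<alpha>) \<inter> Mod L P Ab {\<beta>} \<subseteq> Mod L P Ab (star T (FAnd \<alpha> \<beta>))"
proof -
  have "Mod L P Ab (star T \<alpha>) \<inter> Mod L P Ab {\<beta>} = Mod L P Ab (expansion L P Ab (star T \<alpha>) \<beta>)"
    using assms by (simp add: Mod_expansion star_subset_sentences)
  also have "\<dots> \<subseteq> Mod L P Ab (star T (FAnd \<alpha> \<beta>))"
    by (intro Mod_antimono superexpansion assms)
  finally show ?thesis .
qed

lemma Mod_star_FAnd_subset_Int: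
  assumes "\<alpha> \<in> sentences L" "\<beta> \<in> sentences L" "FNot \<beta> \<notin> star T \<alpha>"
  shows "Mod L P Ab (star T (FAnd \<alpha> \<beta>)) \<subseteq> Mod L P Ab (star T \<alpha>) \<inter> Mod L P Ab {\<beta>}"
proof -
  have "Mod L P Ab (star T (FAnd \<alpha> \<beta>)) \<subseteq> Mod L P Ab (expansion L P Ab (star T \<alpha>) \<beta>)"
    by (intro Mod_antimono subexpansion assms)
  also have "\<dots> = Mod L P Ab (star T \<alpha>) \<inter> Mod L P Ab {\<beta>}"
    using assms by (simp add: Mod_expansion star_subset_sentences)
  finally show ?thesis .
qed

end

lemma kb_closure_subset_sentences: "kb_closure L KB \<subseteq> sentences L"
  by (simp add: kb_closure_def Cn_subset_sentences)

lemma Mod_kb_closure: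
  assumes "horn_kb L KB"
  shows "Mod L (program KB) (abducibles KB) (kb_closure L KB) = Mod_kb L KB"
  using assms by (simp add: kb_closure_def Mod_kb_def horn_kb_def Mod_Cn)

lemma kb_equiv_refl [simp]: "kb_equiv L KB KB"
  by (simp add: kb_equiv_def)

lemma kb_closure_cong:
  assumes "kb_equiv L KB KB'"
  shows "kb_closure L KB = kb_closure L KB'"
  using assms unfolding kb_equiv_def kb_closure_def Cn_def Mod_Un by metis

theorem theorem7:
  fixes L :: "('f, 'p) language"
    and KB :: "('f, 'p) kb"
    and star :: "('f, 'p) fm set \<Rightarrow> ('f, 'p) fm \<Rightarrow> ('f, 'p) fm set"
    and revise :: "('f, 'p) kb \<Rightarrow> ('f, 'p) fm \<Rightarrow> ('f, 'p) kb"
  assumes "horn_kb L KB"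
    and "constraints KB = {}"
    and "agm_revision_postulates L (program KB) (abducibles KB) (kb_closure L KB) star"
    and "\<And>KB' \<alpha>. horn_kb L KB' \<Longrightarrow> kb_equiv L KB KB' \<Longrightarrow> \<alpha> \<in> sentences L \<Longrightarrow>
           horn_kb L (revise KB' \<alpha>) \<and>
           program (revise KB' \<alpha>) = program KB' \<and>
           abducibles (revise KB' \<alpha>) = abducibles KB' \<and>
           constraints (revise KB' \<alpha>) = constraints KB' \<and>
           kb_closure L (revise KB' \<alpha>) = star (kb_closure L KB') \<alpha>"
  shows "kb_revision_postulates L KB revise"
proof -
  let ?T = "kb_closure L KB" and ?M = "Mod L (program KB) (abducibles KB)"
  interpret agm_revision L "program KB" "abducibles KB" ?T star
    using kb_closure_subset_sentences assms(3) by (rule agm_revision.intro)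
  have Mod_revise: "Mod_kb L (revise KB' \<alpha>) = ?M (star ?T \<alpha>)"
    if "horn_kb L KB'" "kb_equiv L KB KB'" "\<alpha> \<in> sentences L" for KB' \<alpha>
    using assms(4)[OF that] kb_closure_cong[OF that(2)] that(2)
      Mod_kb_closure[of L "revise KB' \<alpha>"] by (simp add: kb_equiv_def)
  show ?thesis
    unfolding kb_revision_postulates_def Let_def accepted_def
  proof (intro conjI ballI allI impI)
    fix KB' \<alpha> \<beta>
    assume "\<alpha> \<in> sentences L" "\<beta> \<in> sentences L"
      "horn_kb L KB' \<and> kb_equiv L KB KB' \<and> ?M {\<alpha>} = ?M {\<beta>}"
    then show "Mod_kb L (revise KB \<alpha>) = Mod_kb L (revise KB' \<beta>)"
      using star_cong_Mod[of \<alpha> \<beta>] by (simp add: Mod_revise assms(1))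
  next
    fix \<alpha> \<beta>
    assume "\<alpha> \<in> sentences L" "\<beta> \<in> sentences L" "FNot \<beta> \<notin> kb_closure L (revise KB \<alpha>)"
    then show "Mod_kb L (revise KB (FAnd \<alpha> \<beta>)) \<subseteq> Mod_kb L (revise KB \<alpha>) \<inter> ?M {\<beta>}"
      using Mod_star_FAnd_subset_Int[of \<alpha> \<beta>] by (simp add: Mod_revise assms(1,4))
  qed (simp_all add: assms success Mod_revise Mod_kb_closure
      Mod_star_eq_empty_iff Mod_star_eq_Int Mod_star_Int_subset_FAnd)
qed

end
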